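(* Let $m<n$, let $X\in\mathbb{C}^{m\times n}$ have full row rank, let $y\in\mathbb{C}^m$, and let $\beta_{LN}=X^*(XX^* )^{-1}y$ be the least Euclidean norm solution of $X\beta=y$. Let $(\beta_t)_{t\ge0}$ be the iterates of the Randomized Kaczmarz algorithm (defined in the context) started from a deterministic $\beta_0$ in the row span of $X$ (i.e. in the range of $X^*$; for example $\beta_0=0$). Put $\Sigma=X^*X$ and let $\lambda_{\min}(\Sigma)$ be the smallest positive eigenvalue of $\Sigma$. Then for every integer $t\ge0$, $$\mathbb{E}\,\|\beta_t-\beta_{LN}\|_2^2\;\le\;\left(1-\frac{\lambda_{\min}(\Sigma)}{\operatorname{Tr}(\Sigma)}\right)^{t}\|\beta_0-\beta_{LN}\|_2^2 .$$
   Context: $X^i$ is the $i$th row of $X$ (a row vector), $y^i$ is the $i$th entry of $y$, $X^*$ is the conjugate transpose and $\|X\|_F$ the Frobenius norm. Randomized Kaczmarz (RK): at each step, a row index $i\in\{1,\dots,m\}$ is chosen, independently of previous choices, with probability $\|X^i\|_2^2/\|X\|_F^2$, and $$\beta_{t+1}=\beta_t+\frac{y^i-X^i\beta_t}{\|X^i\|_2^2}\,(X^i)^*.$$ $\mathbb{E}$ is the expectation over all random row choices. The convention $0^0=1$ is used. *)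

theory Defs
  imports "HOL-Probability.Probability"
begin

definition conj_transpose :: "complex^'n^'m \<Rightarrow> complex^'m^'n"
  where "conj_transpose A = (\<chi> i j. cnj (A $ j $ i))"

definition is_eigenvalue :: "complex^'n^'n \<Rightarrow> complex \<Rightarrow> bool"
  where "is_eigenvalue A l \<longleftrightarrow> (\<exists>v. v \<noteq> 0 \<and> A *v v = l *s v)"

text \<open>
  The smallest positive (real) eigenvalue. It is only meaningful for matrices
  with at least one positive eigenvalue, such as the Gram matrix of a nonzero matrix.
\<close>

definition lambda_min :: "complex^'n^'n \<Rightarrow> real"
  where "lambda_min A = (LEAST l::real. 0 < l \<and> is_eigenvalue A (complex_of_real l))"

definition beta_LN :: "complex^'n^'m \<Rightarrow> complex^'m \<Rightarrow> complex^'n"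
  where "beta_LN X y =
    conj_transpose X *v (matrix_inv (X ** conj_transpose X) *v y)"

text \<open>The product of a row \<open>X $ i\<close> with \<open>b\<close> is the unconjugated sum \<open>(X *v b) $ i\<close>.\<close>

definition rk_step :: "complex^'n^'m \<Rightarrow> complex^'m \<Rightarrow> 'm \<Rightarrow> complex^'n \<Rightarrow> complex^'n"
  where "rk_step X y i b =
    b + ((y $ i - (X *v b) $ i) / complex_of_real ((norm (X $ i))\<^sup>2)) *s (\<chi> j. cnj (X $ i $ j))"

text \<open>The iterates for a given sequence \<open>r\<close> of row indices, started from \<open>b0\<close>.\<close>

primrec rk_iter ::
  "complex^'n^'m \<Rightarrow> complex^'m \<Rightarrow> complex^'n \<Rightarrow> (nat \<Rightarrow> 'm) \<Rightarrow> nat \<Rightarrow> complex^'n"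
  where
    "rk_iter X y b0 r 0 = b0"
  | "rk_iter X y b0 r (Suc t) = rk_step X y (r t) (rk_iter X y b0 r t)"

text \<open>The library norm of a matrix \<open>complex^'n^'m\<close> is its Frobenius norm.\<close>

lemma norm_matrix_frobenius:
  fixes X :: "complex^'n^'m"
  shows "norm X = sqrt (\<Sum>i\<in>UNIV. \<Sum>j\<in>UNIV. (cmod (X $ i $ j))\<^sup>2)"
  by (simp add: norm_vec_def L2_set_def sum_nonneg)

text \<open>
  \<open>R t\<close> is the random row index chosen at step \<open>t\<close>: the choices are independent, and each
  row is chosen with probability proportional to its squared Euclidean norm.
\<close>

definition rk_row_choices :: "'w measure \<Rightarrow> complex^'n^'m \<Rightarrow> (nat \<Rightarrow> 'w \<Rightarrow> 'm) \<Rightarrow> bool"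
  where "rk_row_choices M X R \<longleftrightarrow>
    prob_space M \<and>
    prob_space.indep_vars M (\<lambda>_. count_space UNIV) R UNIV \<and>
    (\<forall>t i. measure M {w \<in> space M. R t w = i} = (norm (X $ i))\<^sup>2 / (norm X)\<^sup>2)"

end

theory Submission
  imports Defs
begin

text \<open>
  Each step is the orthogonal projection onto the hyperplane of the chosen equation, so by
  Pythagoras it reduces the squared error by \<open>|(X e)\<^sub>i|\<^sup>2 / \<parallel>X\<^sup>i\<parallel>\<^sup>2\<close>, where \<open>e\<close> is the current error.
  Since the choice of row is independent of \<open>e\<close>, the expected reduction is
  \<open>\<parallel>X e\<parallel>\<^sup>2 / \<parallel>X\<parallel>\<^sup>2\<close>. The errors stay in the range of \<open>X\<^sup>*\<close>, on which the least value of
  \<open>\<parallel>X e\<parallel>\<^sup>2 / \<parallel>e\<parallel>\<^sup>2\<close> is the smallest positive eigenvalue of \<open>X\<^sup>* X\<close>.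
  Adjoints are taken with respect to the real inner product of the library, which is the real
  part of the Hermitian one; this suffices throughout.
\<close>

section \<open>Real adjoints, norms and the trace of the Gram matrix\<close>

lemma inner_matrix_vector_mult:
  fixes A :: "complex^'n^'m"
  shows "inner (A *v x) z = inner x (conj_transpose A *v z)"
proof -
  have "inner (A *v x) z = (\<Sum>i\<in>UNIV. \<Sum>j\<in>UNIV. Re (A $ i $ j * x $ j * cnj (z $ i)))"
    by (simp add: inner_vec_def inner_complex_def matrix_vector_mult_def sum_distrib_right
        flip: sum.distrib)
  also have "\<dots> = (\<Sum>j\<in>UNIV. \<Sum>i\<in>UNIV. Re (A $ i $ j * x $ j * cnj (z $ i)))"
    by (rule sum.swap)
  also have "\<dots> = inner x (conj_transpose A *v z)"
    by (simp add: inner_vec_def inner_complex_def matrix_vector_mult_def conj_transpose_def)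
      (simp add: sum_distrib_left algebra_simps sum.distrib sum_subtractf sum_negf)
  finally show ?thesis .
qed

lemma of_real_vector_scalar_mult:
  fixes v :: "complex^'n"
  shows "complex_of_real r *s v = r *\<^sub>R v"
  by (simp add: vec_eq_iff) (simp add: scaleR_conv_of_real)

lemma norm_vector_scalar_mult:
  fixes v :: "complex^'n"
  shows "norm (c *s v) = cmod c * norm v"
  by (simp add: norm_vec_def L2_set_def norm_mult power_mult_distrib real_sqrt_mult
      flip: sum_distrib_left)

lemma norm_vec_square:
  fixes v :: "'a::real_normed_vector^'n"
  shows "(norm v)\<^sup>2 = (\<Sum>i\<in>UNIV. (norm (v $ i))\<^sup>2)"
  by (simp add: norm_vec_def L2_set_def sum_nonneg)

lemma Re_trace_gram:
  fixes X :: "complex^'n^'m"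
  shows "Re (trace (conj_transpose X ** X)) = (norm X)\<^sup>2"
proof -
  have "Re (trace (conj_transpose X ** X)) = (\<Sum>j\<in>UNIV. \<Sum>i\<in>UNIV. (cmod (X $ i $ j))\<^sup>2)"
    by (simp add: trace_def matrix_matrix_mult_def conj_transpose_def cmod_power2 flip: power2_eq_square)
  also have "\<dots> = (norm X)\<^sup>2"
    unfolding norm_vec_square by (rule sum.swap)
  finally show ?thesis .
qed

section \<open>The range of the adjoint and the smallest positive eigenvalue\<close>

lemma subspace_range_matrix_vector_mult:
  fixes A :: "complex^'n^'m"
  shows "subspace (range ((*v) A))"
  using linear_subspace_image[OF matrix_vector_mul_linear subspace_UNIV] .

text \<open>The range of the adjoint meets the kernel of \<open>X\<close> only in 0: if
  \<open>e = conj_transpose X *v z\<close>, then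
  \<open>inner e e = inner (X *v e) z\<close>.\<close>

lemma matrix_vector_mult_eq_0_iff_range:
  fixes X :: "complex^'n^'m"
  assumes "e \<in> range ((*v) (conj_transpose X))"
  shows "X *v e = 0 \<longleftrightarrow> e = 0"
proof
  obtain z where z: "e = conj_transpose X *v z" using assms by auto
  assume "X *v e = 0"
  then have "inner e e = 0"
    using inner_matrix_vector_mult[of X e z] z by simp
  then show "e = 0" by simp
qed simp

text \<open>Rayleigh quotient argument: compactness gives a minimiser \<open>e\<close> on the unit
  sphere of the range, stationarity makes it an eigenvector, and every eigenvector for a positive
  eigenvalue competes in the same minimum. Hence the \<open>LEAST\<close> in
  \<open>lambda_min\<close> is attained.\<close>

lemma lambda_min_gram:
  fixes X :: "complex^'n^'m"
  assumes "X \<noteq> 0"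
  obtains e where "e \<in> range ((*v) (conj_transpose X))" "norm e = 1"
    "lambda_min (conj_transpose X ** X) = (norm (X *v e))\<^sup>2"
    "\<And>v. v \<in> range ((*v) (conj_transpose X)) \<Longrightarrow>
      lambda_min (conj_transpose X ** X) * (norm v)\<^sup>2 \<le> (norm (X *v v))\<^sup>2"
proof -
  let ?V = "range ((*v) (conj_transpose X))"
  let ?S = "conj_transpose X ** X"
  note V = subspace_range_matrix_vector_mult[of "conj_transpose X"]
  have linX: "linear ((*v) X)" by simp
  \<comment> \<open>This makes the unit sphere of \<open>?V\<close> nonempty, so that a minimum over
    it exists.\<close>
  have "\<exists>v\<in>?V. v \<noteq> 0"
  proof (rule ccontr)
    assume "\<not> ?thesis"
    then have "conj_transpose X *v z = 0" for z by blast
    then have "inner (X *v x) (X *v x) = 0" for x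
      by (simp add: inner_matrix_vector_mult)
    then have "X *v x = 0 *v x" for x by simp
    then show False using assms matrix_eq by blast
  qed
  then obtain v0 where v0: "v0 \<in> ?V" "v0 \<noteq> 0" by blast
  have "compact (?V \<inter> sphere 0 1)"
    by (simp add: V closed_subspace closed_Int_compact)
  moreover have "v0 /\<^sub>R norm v0 \<in> ?V \<inter> sphere 0 1"
    using v0 subspace_scale[OF V] by simp
  moreover have "continuous_on (?V \<inter> sphere 0 1) (\<lambda>e. (norm (X *v e))\<^sup>2)"
    by (intro continuous_intros linear_continuous_on) simp
  ultimately obtain e where e: "e \<in> ?V" "norm e = 1"
    and e_min: "\<And>v. v \<in> ?V \<Longrightarrow> norm v = 1 \<Longrightarrow> (norm (X *v e))\<^sup>2 \<le> (norm (X *v v))\<^sup>2"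
    using continuous_attains_inf[of "?V \<inter> sphere 0 1" "\<lambda>e. (norm (X *v e))\<^sup>2"]
    by (metis (no_types, lifting) IntD1 IntD2 IntI empty_iff mem_sphere_0)
  define \<mu> where "\<mu> = (norm (X *v e))\<^sup>2"
  have ge: "\<mu> * (norm v)\<^sup>2 \<le> (norm (X *v v))\<^sup>2" if "v \<in> ?V" for v
  proof (cases "v = 0")
    case False
    have "\<mu> \<le> (norm (X *v (v /\<^sub>R norm v)))\<^sup>2"
      unfolding \<mu>_def using False that subspace_scale[OF V] by (intro e_min) auto
    then show ?thesis
      using False by (simp add: linear_scale[OF linX] field_simps)
  qed simp
  have "\<mu> > 0"
    using matrix_vector_mult_eq_0_iff_range[OF e(1)] e(2) by (auto simp: \<mu>_def)
  \<comment> \<open>The residual of the eigenvector equation at \<open>e\<close>. Both terms lie in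
    \<open>?V\<close>, so \<open>w\<close> is an admissible direction in which to vary the
    minimiser.\<close>
  define w where "w = ?S *v e - \<mu> *\<^sub>R e"
  have Sv: "?S *v v = conj_transpose X *v (X *v v)" for v
    by (simp add: matrix_vector_mul_assoc)
  have "w \<in> ?V"
    unfolding w_def Sv using e by (intro subspace_diff[OF V] subspace_scale[OF V]) auto
  define q where "q = (norm (X *v w))\<^sup>2 - \<mu> * (norm w)\<^sup>2"
  have "q \<ge> 0" using ge[OF \<open>w \<in> ?V\<close>] by (simp add: q_def)
  \<comment> \<open>The nonnegative form \<open>\<lambda>v. (norm (X *v v))\<^sup>2 - \<mu> * (norm v)\<^sup>2\<close> vanishes at \<open>e\<close>,
    so its derivative at \<open>e\<close> in the direction of \<open>w\<close>, which is \<open>2 * (norm w)\<^sup>2\<close>, is zero.\<close>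
  have quad: "0 \<le> 2 * s * (norm w)\<^sup>2 + s\<^sup>2 * q" for s
  proof -
    have "e + s *\<^sub>R w \<in> ?V"
      using e \<open>w \<in> ?V\<close> by (intro subspace_add[OF V] subspace_scale[OF V])
    from ge[OF this] have "0 \<le> inner (X *v (e + s *\<^sub>R w)) (X *v (e + s *\<^sub>R w))
        - \<mu> * inner (e + s *\<^sub>R w) (e + s *\<^sub>R w)"
      by (simp add: power2_norm_eq_inner)
    also have "\<dots> = inner (X *v e) (X *v e) - \<mu> * inner e e
        + 2 * s * (inner (X *v w) (X *v e) - \<mu> * inner w e)
        + s\<^sup>2 * (inner (X *v w) (X *v w) - \<mu> * inner w w)"
      by (simp add: linear_add[OF linX] linear_scale[OF linX] inner_simps inner_commute
          power2_eq_square algebra_simps)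
    \<comment> \<open>Moving \<open>X\<close> across the inner product turns the first-order
      coefficient into \<open>inner w (?S *v e) - \<mu> * inner w e\<close>; only the second factor
      of \<open>inner w w\<close> is unfolded to match it.\<close>
    also have "inner (X *v w) (X *v e) - \<mu> * inner w e = inner w w"
      unfolding inner_matrix_vector_mult Sv[symmetric] by (subst (4) w_def) (simp add: inner_simps)
    also have "inner (X *v e) (X *v e) - \<mu> * inner e e = 0"
      using e by (simp add: \<mu>_def flip: power2_norm_eq_inner)
    finally show ?thesis by (simp add: q_def power2_norm_eq_inner)
  qed
  have "(norm w)\<^sup>2 = 0"
  proof (rule ccontr)
    assume "(norm w)\<^sup>2 \<noteq> 0"
    then have W: "(norm w)\<^sup>2 > 0" by simp
    \<comment> \<open>With this \<open>s\<close> the quadratic equals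
      \<open>s * ((norm w)\<^sup>2 - s)\<close>, which is negative. Adding 1 keeps the denominator
      positive when \<open>q = 0\<close>.\<close>
    define s where "s = - (norm w)\<^sup>2 / (q + 1)"
    have "s * (q + 1) = - (norm w)\<^sup>2" using \<open>q \<ge> 0\<close> by (simp add: s_def)
    moreover have "s < 0" using W \<open>q \<ge> 0\<close> by (simp add: s_def field_simps)
    moreover have "2 * s * (norm w)\<^sup>2 + s\<^sup>2 * q = s * ((norm w)\<^sup>2 + s * (q + 1) + (norm w)\<^sup>2 - s)"
      by (simp add: algebra_simps power2_eq_square)
    moreover have "s * ((norm w)\<^sup>2 - s) < 0"
      using \<open>s < 0\<close> W by (intro mult_neg_pos) linarith+
    ultimately show False using quad[of s] by simp
  qed
  then have "?S *v e = complex_of_real \<mu> *s e"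
    by (simp add: w_def of_real_vector_scalar_mult)
  then have "is_eigenvalue ?S (complex_of_real \<mu>)"
    using e unfolding is_eigenvalue_def by (metis norm_zero zero_neq_one)
  moreover have "\<mu> \<le> l" if l: "0 < l" "is_eigenvalue ?S (complex_of_real l)" for l
  proof -
    obtain v where v: "v \<noteq> 0" "?S *v v = l *\<^sub>R v"
      using l(2) by (auto simp: is_eigenvalue_def of_real_vector_scalar_mult)
    \<comment> \<open>An eigenvector for a nonzero eigenvalue is a multiple of its own image, hence
      lies in \<open>?V\<close>, where the minimality of \<open>\<mu>\<close> applies.\<close>
    then have "v = (1 / l) *\<^sub>R (conj_transpose X *v (X *v v))"
      using \<open>0 < l\<close> by (simp flip: Sv)
    then have "v \<in> ?V" using subspace_scale[OF V] by (metis rangeI)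
    have "(norm (X *v v))\<^sup>2 = l * (norm v)\<^sup>2"
      using v by (simp add: power2_norm_eq_inner inner_matrix_vector_mult flip: Sv)
    with ge[OF \<open>v \<in> ?V\<close>] v(1) show ?thesis by simp
  qed
  ultimately have "lambda_min ?S = \<mu>"
    unfolding lambda_min_def using \<open>\<mu> > 0\<close> by (intro Least_equality) auto
  with e ge show ?thesis by (intro that[of e]) (auto simp: \<mu>_def)
qed

section \<open>Full row rank and the least norm solution\<close>

text \<open>The rank is the dimension of the span of the set \<open>rows X\<close>, in which equal
  rows would collapse. Counting shows that the rows are distinct and independent, and independence
  of the indexed rows amounts to a right inverse.\<close>

lemma full_row_rank_imp_right_invertible:
  fixes X :: "'a::field^'n^'m"
  assumes "rank X = CARD('m)"
  obtains B where "X ** B = mat 1"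
proof -
  have rows: "rows X = range (\<lambda>i. row i X)" by (auto simp: rows_def)
  have "CARD('m) \<le> card (rows X)"
    using vec.dim_le_card'[of "rows X"] assms by (simp add: row_rank_def_gen rows)
  then have card: "card (rows X) = CARD('m)"
    using card_image_le[of UNIV "\<lambda>i. row i X"] by (simp add: rows)
  then have inj: "inj (\<lambda>i. row i X)"
    by (intro eq_card_imp_inj_on) (auto simp: rows)
  then have the_inv: "the_inv (\<lambda>i. row i X) (row j X) = j" for j
    by (rule the_inv_f_f)
  have ind: "vec.independent (rows X)"
    using assms card vec.card_le_dim_spanning vec.card_eq_dim[of "rows X" "rows X"] vec.span_superset
    by (simp add: row_rank_def_gen rows)
  \<comment> \<open>Independence passes from the set of rows to the indexed family by giving each
    row vector the coefficient of its unique index.\<close>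
  have "c i = 0" if "(\<Sum>i\<in>UNIV. c i *s row i X) = 0" for c i
  proof -
    have "(\<Sum>v\<in>rows X. c (the_inv (\<lambda>i. row i X) v) *s v) = 0"
      unfolding rows sum.reindex[OF inj] o_def the_inv by (rule that)
    then have "c (the_inv (\<lambda>i. row i X) (row i X)) = 0"
      by (rule vec.independentD[OF ind _ subset_refl, where u = "\<lambda>v. c (the_inv (\<lambda>i. row i X) v)",
            rotated]) (simp_all add: rows)
    then show ?thesis by (simp add: the_inv)
  qed
  then have "\<exists>B. X ** B = mat 1"
    unfolding matrix_right_invertible_independent_rows by blast
  then show ?thesis using that by blast
qed

text \<open>\<open>matrix_inv\<close> is a genuine inverse here because
  \<open>X ** conj_transpose X\<close> has trivial kernel: such a \<open>z\<close> satisfies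
  \<open>conj_transpose X *v z = 0\<close>, and \<open>X ** B = mat 1\<close> then gives
  \<open>inner z z = inner (B *v z) (conj_transpose X *v z) = 0\<close>.\<close>

lemma beta_LN_solves:
  fixes X :: "complex^'n^'m"
  assumes "rank X = CARD('m)"
  shows "X *v beta_LN X y = y"
proof -
  obtain B where B: "X ** B = mat 1"
    using full_row_rank_imp_right_invertible[OF assms] .
  have "z = 0" if z: "(X ** conj_transpose X) *v z = 0" for z
  proof -
    have "conj_transpose X *v z = 0"
      using matrix_vector_mult_eq_0_iff_range[of "conj_transpose X *v z" X] z
      by (simp add: matrix_vector_mul_assoc)
    then have "inner (X *v (B *v z)) z = 0"
      unfolding inner_matrix_vector_mult by simp
    then show "z = 0" by (simp add: matrix_vector_mul_assoc B)
  qed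
  then have "invertible (X ** conj_transpose X)"
    by (simp add: invertible_left_inverse matrix_left_invertible_ker)
  then have "(X ** conj_transpose X) ** matrix_inv (X ** conj_transpose X) = mat 1"
    unfolding invertible_def matrix_inv_def by (rule someI2_ex) simp
  then show ?thesis
    by (simp add: beta_LN_def matrix_vector_mul_assoc matrix_mul_assoc)
qed

section \<open>The error along a fixed sequence of rows\<close>

text \<open>The step subtracts from the error its Hermitian projection onto the conjugated row, so
  Pythagoras applies. For a zero row, division by zero yields 0 and both sides reduce to the old
  error.\<close>

lemma rk_step_error:
  fixes X :: "complex^'n^'m"
  assumes "X *v s = y"
  shows "(norm (rk_step X y i b - s))\<^sup>2 =
    (norm (b - s))\<^sup>2 - (cmod ((X *v (b - s)) $ i))\<^sup>2 / (norm (X $ i))\<^sup>2"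
proof -
  define e where "e = b - s"
  define c where "c = (X *v e) $ i / complex_of_real ((norm (X $ i))\<^sup>2)"
  define a where "a = (\<chi> j. cnj (X $ i $ j))"
  have "y $ i - (X *v b) $ i = - (X *v e) $ i"
    using assms by (auto simp: e_def matrix_vector_mult_diff_distrib)
  then have step: "rk_step X y i b - s = e - c *s a"
    by (simp add: rk_step_def e_def c_def a_def vec_eq_iff)
  have "norm a = norm (X $ i)"
    by (simp add: a_def norm_vec_def)
  then have ca: "(norm (c *s a))\<^sup>2 = (cmod ((X *v e) $ i))\<^sup>2 / (norm (X $ i))\<^sup>2"
    by (simp add: norm_vector_scalar_mult c_def norm_divide norm_power power_divide
        power_mult_distrib) (simp add: power2_eq_square power4_eq_xxxx)
  \<comment> \<open>The aim is \<open>inner e (c *s a) = (norm (c *s a))\<^sup>2\<close>, which says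
    that \<open>e - c *s a\<close> is orthogonal to \<open>c *s a\<close>.\<close>
  have "inner e (c *s a) = (\<Sum>j\<in>UNIV. inner (X $ i $ j * e $ j) c)"
    by (simp add: inner_vec_def inner_complex_def a_def algebra_simps)
  also have "\<dots> = inner ((X *v e) $ i) c"
    by (simp add: matrix_vector_mult_def inner_sum_left)
  also have "\<dots> = (cmod ((X *v e) $ i))\<^sup>2 / (norm (X $ i))\<^sup>2"
    unfolding c_def by (simp add: inner_complex_def cmod_power2 add_divide_distrib flip: power2_eq_square)
  finally have "inner e (c *s a) = (norm (c *s a))\<^sup>2" using ca by simp
  then show ?thesis
    unfolding step e_def[symmetric] ca[symmetric]
    by (simp add: power2_norm_eq_inner inner_simps inner_commute)
qed

text \<open>Each correction is a multiple of a column of \<open>conj_transpose X\<close>, the image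
  of an axis vector.\<close>

lemma rk_iter_in_range:
  fixes X :: "complex^'n^'m"
  assumes "b0 \<in> range ((*v) (conj_transpose X))"
  shows "rk_iter X y b0 r t \<in> range ((*v) (conj_transpose X))"
proof (induction t)
  case (Suc t)
  define b where "b = rk_iter X y b0 r t"
  define c where "c = (y $ r t - (X *v b) $ r t) / complex_of_real ((norm (X $ r t))\<^sup>2)"
  obtain z where z: "b = conj_transpose X *v z" using Suc by (auto simp: b_def)
  have "conj_transpose X *v axis (r t) 1 = (\<chi> j. cnj (X $ r t $ j))"
    by (simp add: conj_transpose_def matrix_vector_mult_def axis_def vec_eq_iff
        if_distrib[of "(*) _"] cong: if_cong)
  then have "rk_step X y (r t) b = b + c *s (conj_transpose X *v axis (r t) 1)"
    by (simp add: rk_step_def c_def)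
  also have "\<dots> = conj_transpose X *v (z + c *s axis (r t) 1)"
    by (simp add: z vec.add vec.scale)
  finally show ?case by (simp add: b_def)
qed (simp add: assms)

text \<open>No step increases the error. The bound is uniform in the sequence \<open>r\<close>,
  which later gives integrability.\<close>

lemma norm_rk_iter_error_le:
  assumes "X *v s = y"
  shows "norm (rk_iter X y b0 r t - s) \<le> norm (b0 - s)"
proof (induction t)
  case (Suc t)
  have "(norm (rk_iter X y b0 r (Suc t) - s))\<^sup>2 \<le> (norm (rk_iter X y b0 r t - s))\<^sup>2"
    by (simp add: rk_step_error[OF assms])
  then show ?case using Suc by (simp add: power2_le_iff_abs_le)
qed simp

text \<open>The strict inequality \<open>s < t\<close> is what makes iterate \<open>t\<close>
  independent of the choice made at step \<open>t\<close>.\<close>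

lemma rk_iter_cong:
  "(\<And>s. s < t \<Longrightarrow> r s = r' s) \<Longrightarrow> rk_iter X y b0 r t = rk_iter X y b0 r' t"
  by (induction t) auto

section \<open>Measurability and independence of the iterates\<close>

lemma measurable_rk_step: "rk_step X y i \<in> borel_measurable borel"
proof (rule borel_measurable_continuous_onI)
  \<comment> \<open>Absorbing the division into a constant leaves an affine map in \<open>b\<close>,
    with no denominator for the continuity rules to treat.\<close>
  define k where "k j = cnj (X $ i $ j) / complex_of_real ((norm (X $ i))\<^sup>2)" for j
  have "continuous_on UNIV (\<lambda>b. b + (\<chi> j. (y $ i - (X *v b) $ i) * k j))"
    by (intro continuous_intros continuous_on_vec_lambda)
  also have "(\<lambda>b. b + (\<chi> j. (y $ i - (X *v b) $ i) * k j)) = rk_step X y i"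
    by (simp add: fun_eq_iff rk_step_def k_def vec_eq_iff)
  finally show "continuous_on UNIV (rk_step X y i)" .
qed

text \<open>Row indices range over a finite type, so measurability can be checked for each fixed
  index. The general \<open>N\<close> covers both the probability space and the product space of the
  first \<open>t\<close> choices.\<close>

lemma measurable_rk_iter:
  assumes "\<And>s. s < t \<Longrightarrow> (\<lambda>w. R w s) \<in> N \<rightarrow>\<^sub>M count_space UNIV"
  shows "(\<lambda>w. rk_iter X y b0 (R w) t) \<in> borel_measurable N"
  using assms
proof (induction t)
  case (Suc t)
  have "(\<lambda>w. rk_step X y (R w t) (rk_iter X y b0 (R w) t)) \<in> borel_measurable N"
  proof (rule measurable_compose_countable'[where g = "\<lambda>w. R w t" and I = UNIV
        and f = "\<lambda>i w. rk_step X y i (rk_iter X y b0 (R w) t)"])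
    show "(\<lambda>w. rk_step X y i (rk_iter X y b0 (R w) t)) \<in> borel_measurable N" for i
      by (rule measurable_compose[OF Suc.IH measurable_rk_step]) (simp add: Suc.prems)
    show "(\<lambda>w. R w t) \<in> N \<rightarrow>\<^sub>M count_space UNIV" using Suc.prems by simp
  qed simp
  then show ?case by simp
qed simp

text \<open>The two variables are functions of the choices in the disjoint index blocks
  \<open>{..<t}\<close> and \<open>{t}\<close>.\<close>

lemma (in prob_space) indep_var_rk_iter:
  assumes "indep_vars (\<lambda>_. count_space UNIV) R UNIV" and "g \<in> borel \<rightarrow>\<^sub>M N"
    and "h \<in> count_space UNIV \<rightarrow>\<^sub>M N'"
  shows "indep_var N (\<lambda>w. g (rk_iter X y b0 (\<lambda>s. R s w) t)) N' (\<lambda>w. h (R t w))"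
proof -
  have "indep_var N ((\<lambda>r. g (rk_iter X y b0 r t)) \<circ> (\<lambda>w. \<lambda>s\<in>{..<t}. R s w))
      N' ((\<lambda>r. h (r t)) \<circ> (\<lambda>w. \<lambda>s\<in>{t}. R s w))"
    by (intro indep_var_compose[OF indep_var_restrict[OF assms(1)]]
        measurable_compose[OF _ assms(2)] measurable_compose[OF _ assms(3)] measurable_rk_iter) auto
  \<comment> \<open>Restriction makes the choices from \<open>t\<close> on \<open>undefined\<close>,
    but iterate \<open>t\<close> does not read them.\<close>
  also have "(\<lambda>r. g (rk_iter X y b0 r t)) \<circ> (\<lambda>w. \<lambda>s\<in>{..<t}. R s w)
      = (\<lambda>w. g (rk_iter X y b0 (\<lambda>s. R s w) t))"
    by (rule ext) (auto intro!: arg_cong[where f = g] rk_iter_cong)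
  also have "(\<lambda>r. h (r t)) \<circ> (\<lambda>w. \<lambda>s\<in>{t}. R s w) = (\<lambda>w. h (R t w))"
    by auto
  finally show ?thesis .
qed

section \<open>The expected error\<close>

text \<open>Splitting the reduction by the chosen row replaces conditioning on the past: each
  summand is a product of a function of the error and an independent indicator, so its expectation
  factorises.\<close>

lemma rk_expected_error_Suc:
  fixes X :: "complex^'n^'m" and M :: "'w measure"
  assumes R: "rk_row_choices M X R" and s: "X *v s = y"
  shows "prob_space.expectation M (\<lambda>w. (norm (rk_iter X y b0 (\<lambda>s. R s w) (Suc t) - s))\<^sup>2) =
    prob_space.expectation M (\<lambda>w. (norm (rk_iter X y b0 (\<lambda>s. R s w) t - s))\<^sup>2
      - (norm (X *v (rk_iter X y b0 (\<lambda>s. R s w) t - s)))\<^sup>2 / (norm X)\<^sup>2)"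
    and "integrable M (\<lambda>w. (norm (rk_iter X y b0 (\<lambda>s. R s w) t - s))\<^sup>2)"
    and "integrable M (\<lambda>w. (norm (X *v (rk_iter X y b0 (\<lambda>s. R s w) t - s)))\<^sup>2)"
proof -
  interpret prob_space M using R by (simp add: rk_row_choices_def)
  have ind: "indep_vars (\<lambda>_. count_space UNIV) R UNIV"
    and p: "\<And>i. prob {w \<in> space M. R t w = i} = (norm (X $ i))\<^sup>2 / (norm X)\<^sup>2"
    using R by (auto simp: rk_row_choices_def)
  have [measurable]: "R k \<in> M \<rightarrow>\<^sub>M count_space UNIV" for k
    using ind by (auto simp: indep_vars_def)
  define e where "e w = rk_iter X y b0 (\<lambda>s. R s w) t - s" for w
  define d where "d i v = (cmod ((X *v v) $ i))\<^sup>2 / (norm (X $ i))\<^sup>2" for i and v :: "complex^'n"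
  have [measurable]: "e \<in> borel_measurable M"
    unfolding e_def by (intro borel_measurable_diff measurable_rk_iter) auto
  have e_bound: "norm (e w) \<le> norm (b0 - s)" for w
    unfolding e_def by (rule norm_rk_iter_error_le[OF s])
  \<comment> \<open>All errors lie in one ball, on which a continuous function is bounded.\<close>
  have int_cont: "integrable M (\<lambda>w. g (e w))" if g: "continuous_on UNIV g"
    for g :: "complex^'n \<Rightarrow> real"
  proof -
    have "compact (g ` cball 0 (norm (b0 - s)))"
      using g by (intro compact_continuous_image) (auto intro: continuous_on_subset)
    then obtain B where "\<forall>v\<in>cball 0 (norm (b0 - s)). norm (g v) \<le> B"
      by (auto dest!: compact_imp_bounded simp: bounded_iff)
    moreover have "g \<in> borel_measurable borel"
      using g by (rule borel_measurable_continuous_onI)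
    ultimately show ?thesis
      using e_bound by (intro integrable_const_bound[where B = B]) auto
  qed
  have cont: "continuous_on UNIV (\<lambda>v. (norm v)\<^sup>2)" "continuous_on UNIV (\<lambda>v. (norm (X *v v))\<^sup>2)"
    "continuous_on UNIV (d i)" for i
    unfolding d_def divide_inverse by (intro continuous_intros)+
  show int: "integrable M (\<lambda>w. (norm (rk_iter X y b0 (\<lambda>s. R s w) t - s))\<^sup>2)"
    "integrable M (\<lambda>w. (norm (X *v (rk_iter X y b0 (\<lambda>s. R s w) t - s)))\<^sup>2)"
    using int_cont[OF cont(1)] int_cont[OF cont(2)] by (simp_all add: e_def)
  \<comment> \<open>The row norm in \<open>d\<close> cancels against the selection probability. For
    a zero row both sides vanish, since the entry of \<open>X *v v\<close> is then 0.\<close>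
  have dX: "(\<Sum>i\<in>UNIV. d i v * ((norm (X $ i))\<^sup>2 / (norm X)\<^sup>2)) = (norm (X *v v))\<^sup>2 / (norm X)\<^sup>2" for v
  proof -
    have "d i v * ((norm (X $ i))\<^sup>2 / (norm X)\<^sup>2) = (cmod ((X *v v) $ i))\<^sup>2 / (norm X)\<^sup>2" for i
      by (cases "X $ i = 0") (auto simp: d_def matrix_vector_mult_def)
    then show ?thesis
      by (simp only: norm_vec_square[of "X *v v"] sum_divide_distrib)
  qed
  have d_ind: "expectation (\<lambda>w. d i (e w) * indicator {i} (R t w)) =
      expectation (\<lambda>w. d i (e w) * ((norm (X $ i))\<^sup>2 / (norm X)\<^sup>2))"
    "integrable M (\<lambda>w. d i (e w) * indicator {i} (R t w))" for i
  proof -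
    have iv: "indep_var borel (\<lambda>w. d i (e w)) borel (\<lambda>w. indicator {i} (R t w) :: real)"
      unfolding e_def
      by (intro indep_var_rk_iter[OF ind, where g = "\<lambda>b. d i (b - s)"]
          measurable_compose[OF _ cont(3)[THEN borel_measurable_continuous_onI]]) auto
    have i1: "integrable M (\<lambda>w. d i (e w))" by (rule int_cont[OF cont(3)])
    have i2: "integrable M (\<lambda>w. indicator {i} (R t w) :: real)"
      by (intro integrable_const_bound[where B = 1]) (auto simp: indicator_def)
    have "expectation (\<lambda>w. indicator {i} (R t w) :: real) = expectation (indicator {w \<in> space M. R t w = i})"
      by (intro Bochner_Integration.integral_cong) (auto simp: indicator_def)
    then have "expectation (\<lambda>w. indicator {i} (R t w) :: real) = prob {w \<in> space M. R t w = i}"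
      by simp
    then show "expectation (\<lambda>w. d i (e w) * indicator {i} (R t w)) =
      expectation (\<lambda>w. d i (e w) * ((norm (X $ i))\<^sup>2 / (norm X)\<^sup>2))"
      using indep_var_lebesgue_integral[OF iv i1 i2] p by simp
    show "integrable M (\<lambda>w. d i (e w) * indicator {i} (R t w))"
      by (rule indep_var_integrable[OF iv i1 i2])
  qed
  \<comment> \<open>Only the summand of the row actually chosen survives.\<close>
  have "(norm (rk_iter X y b0 (\<lambda>s. R s w) (Suc t) - s))\<^sup>2 =
      (norm (e w))\<^sup>2 - (\<Sum>i\<in>UNIV. d i (e w) * indicator {i} (R t w))" for w
  proof -
    have "(\<Sum>i\<in>UNIV. d i (e w) * indicator {i} (R t w)) = d (R t w) (e w)"
      by (subst sum.remove[of _ "R t w"]) (auto intro!: sum.neutral)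
    then show ?thesis by (simp add: rk_step_error[OF s] e_def d_def)
  qed
  then have "expectation (\<lambda>w. (norm (rk_iter X y b0 (\<lambda>s. R s w) (Suc t) - s))\<^sup>2) =
      expectation (\<lambda>w. (norm (e w))\<^sup>2 - (\<Sum>i\<in>UNIV. d i (e w) * indicator {i} (R t w)))"
    by (simp only:)
  also have "\<dots> = expectation (\<lambda>w. (norm (e w))\<^sup>2)
      - (\<Sum>i\<in>UNIV. expectation (\<lambda>w. d i (e w) * indicator {i} (R t w)))"
    using int_cont[OF cont(1)] d_ind(2)
    by (simp only: Bochner_Integration.integral_diff Bochner_Integration.integral_sum
        Bochner_Integration.integrable_sum)
  also have "\<dots> = expectation (\<lambda>w. (norm (e w))\<^sup>2
      - (\<Sum>i\<in>UNIV. d i (e w) * ((norm (X $ i))\<^sup>2 / (norm X)\<^sup>2)))"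
    unfolding d_ind(1) using int_cont[OF cont(1)] int_cont[OF cont(3)]
    by (subst Bochner_Integration.integral_diff)
      (auto intro!: Bochner_Integration.integrable_sum integrable_mult_left
        simp: Bochner_Integration.integral_sum simp del: times_divide_eq_right)
  finally show "expectation (\<lambda>w. (norm (rk_iter X y b0 (\<lambda>s. R s w) (Suc t) - s))\<^sup>2) =
    expectation (\<lambda>w. (norm (rk_iter X y b0 (\<lambda>s. R s w) t - s))\<^sup>2
      - (norm (X *v (rk_iter X y b0 (\<lambda>s. R s w) t - s)))\<^sup>2 / (norm X)\<^sup>2)"
    unfolding dX by (simp add: e_def)
qed

text \<open>This makes the contraction factor nonnegative, so that the bounds for successive steps
  can be multiplied.\<close>

lemma lambda_min_gram_le_norm:
  fixes X :: "complex^'n^'m"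
  assumes "X \<noteq> 0"
  shows "lambda_min (conj_transpose X ** X) \<le> (norm X)\<^sup>2"
proof -
  obtain e where e: "norm e = 1" "lambda_min (conj_transpose X ** X) = (norm (X *v e))\<^sup>2"
    using lambda_min_gram[OF assms] .
  have "(cmod ((X *v e) $ i))\<^sup>2 \<le> (norm (X $ i))\<^sup>2" for i
  proof (cases "X $ i = 0")
    case False
    \<comment> \<open>Cauchy-Schwarz for the unit vector \<open>e\<close>, read off from the
      nonnegative squared error after one step towards the solution 0.\<close>
    have "0 \<le> 1 - (cmod ((X *v e) $ i))\<^sup>2 / (norm (X $ i))\<^sup>2"
      using rk_step_error[of X 0 0 i e] e(1) zero_le_power2[of "norm (rk_step X 0 i e - 0)"] by simp
    then show ?thesis using False by (simp add: pos_divide_le_eq)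
  qed (simp add: matrix_vector_mult_def)
  then show ?thesis
    unfolding e(2) norm_vec_square[of "X *v e"] norm_vec_square[of X] by (rule sum_mono)
qed

theorem mainTheorem2:
  fixes X :: "complex^'n^'m" and y :: "complex^'m" and b0 :: "complex^'n"
    and M :: "'w measure" and R :: "nat \<Rightarrow> 'w \<Rightarrow> 'm" and t :: nat
  assumes "CARD('m) < CARD('n)"
    and "rank X = CARD('m)"
    and "b0 \<in> range (\<lambda>z. conj_transpose X *v z)"
    and "rk_row_choices M X R"
  defines "\<Sigma> \<equiv> conj_transpose X ** X"
  shows "prob_space.expectation M
           (\<lambda>w. (norm (rk_iter X y b0 (\<lambda>s. R s w) t - beta_LN X y))\<^sup>2)
         \<le> (1 - lambda_min \<Sigma> / Re (trace \<Sigma>)) ^ t * (norm (b0 - beta_LN X y))\<^sup>2"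
proof -
  interpret prob_space M using assms(4) by (simp add: rk_row_choices_def)
  define \<beta> where "\<beta> = beta_LN X y"
  define e where "e t w = rk_iter X y b0 (\<lambda>s. R s w) t - \<beta>" for t w
  define c where "c = lambda_min \<Sigma> / (norm X)\<^sup>2"
  have s: "X *v \<beta> = y" unfolding \<beta>_def using beta_LN_solves[OF assms(2)] .
  \<comment> \<open>A zero matrix could not map any vector to the nonzero right-hand side
    \<open>axis undefined 1\<close>.\<close>
  have "X \<noteq> 0"
    using beta_LN_solves[OF assms(2), of "axis undefined 1"] by (auto simp: axis_eq_0_iff)
  have "c \<le> 1"
    using lambda_min_gram_le_norm[OF \<open>X \<noteq> 0\<close>] \<open>X \<noteq> 0\<close> by (simp add: c_def \<Sigma>_def)
  \<comment> \<open>\<open>beta_LN\<close> is itself an image under \<open>conj_transpose X\<close>,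
    so the errors stay where the eigenvalue bound holds.\<close>
  have e_range: "e t w \<in> range ((*v) (conj_transpose X))" for t w
    unfolding e_def \<beta>_def beta_LN_def
    by (intro subspace_diff[OF subspace_range_matrix_vector_mult] rk_iter_in_range assms(3) rangeI)
  have contract: "(norm (e t w))\<^sup>2 - (norm (X *v e t w))\<^sup>2 / (norm X)\<^sup>2 \<le> (1 - c) * (norm (e t w))\<^sup>2" for t w
  proof -
    have "lambda_min \<Sigma> * (norm (e t w))\<^sup>2 \<le> (norm (X *v e t w))\<^sup>2"
      using lambda_min_gram[OF \<open>X \<noteq> 0\<close>] e_range unfolding \<Sigma>_def by metis
    then have "c * (norm (e t w))\<^sup>2 \<le> (norm (X *v e t w))\<^sup>2 / (norm X)\<^sup>2"
      by (simp add: c_def divide_right_mono)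
    then show ?thesis by (simp add: algebra_simps)
  qed
  note step = rk_expected_error_Suc[OF assms(4) s, where ?b0.0 = b0, folded e_def]
  have "expectation (\<lambda>w. (norm (e t w))\<^sup>2) \<le> (1 - c) ^ t * (norm (b0 - \<beta>))\<^sup>2"
  proof (induction t)
    case 0
    then show ?case by (simp add: e_def prob_space)
  next
    case (Suc t)
    have "expectation (\<lambda>w. (norm (e (Suc t) w))\<^sup>2) \<le> expectation (\<lambda>w. (1 - c) * (norm (e t w))\<^sup>2)"
      unfolding step(1) using step(2,3) contract by (intro integral_mono) auto
    also have "\<dots> = (1 - c) * expectation (\<lambda>w. (norm (e t w))\<^sup>2)" by simp
    also have "\<dots> \<le> (1 - c) * ((1 - c) ^ t * (norm (b0 - \<beta>))\<^sup>2)"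
      using \<open>c \<le> 1\<close> Suc by (intro mult_left_mono) auto
    finally show ?case by simp
  qed
  then show ?thesis
    by (simp add: e_def \<beta>_def c_def \<Sigma>_def Re_trace_gram)
qed

end
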